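(* Let $\boldsymbol{\mu}$ be a projection on $K$ types which is entire, finite, nondegenerate, nonlocalized and irreducible. Then for any $\ell\ge1$ and any $\Gamma\in\mathcal{M}^*_{\ell,K}(\mathbb{Z})$, there exists $\theta\in\mathbb{R}^K$ with $\theta\sim_\Gamma\mathbf{0}$ such that $\boldsymbol{\mu}_\theta$ is critical.
   Context: Fix an integer $K\ge1$; $[K]=\{1,\dots,K\}$, $\mathbb{Z}_+=\{0,1,\dots\}$. $\mathcal{M}^*_{\ell,K}(\mathbb{Z})$ is the set of nonzero $\ell\times K$ integer matrices. A projection is a family $\boldsymbol{\mu}=(\mu^{(1)},\dots,\mu^{(K)})$ of probability distributions on $\mathbb{Z}_+^K$, with generating functions $\phi^{(i)}(x_1,\dots,x_K)=\sum_{k\in\mathbb{Z}_+^K}\mu^{(i)}(k)x_1^{k_1}\cdots x_K^{k_K}$ and mean matrix $M=(m_{i,j})$, $m_{i,j}=\sum_{z\in\mathbb{Z}_+^K}z_j\mu^{(i)}(z)$. $\mathcal{T}^{(i)}$ denotes the multitype Bienaymé-Galton-Watson tree with root of type $i$ in which each vertex of type $j$ has, independently, children whose numbers of each type are distributed as $\mu^{(j)}$. $\boldsymbol{\mu}$ is: entire if every $\phi^{(i)}$ is entire; finite if $\mathbb{P}(|\mathcal{T}^{(i)}|<\infty)>0$ for all $i\in[K]$; nondegenerate if $\mu^{(i)}(\{z:\sum_j z_j\ge2\})>0$ for some $i$; nonlocalized if for all $X\in\mathbb{R}^K\setminus\{\mathbf{0}\}$ there is $i\in[K]$ such that, for $(k_1,\dots,k_K)$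 distributed as $\mu^{(i)}$, $\sum_jX_jk_j$ is not deterministic; irreducible if for all $i,j$ there is $p\ge1$ with $(M^p)_{i,j}>0$; critical if the spectral radius of $M$ is $1$. For $\theta\in\mathbb{R}^K$ the exponential tilting $\boldsymbol{\mu}_\theta=(\mu_\theta^{(i)})_{i\in[K]}$ is $\mu^{(i)}_\theta(k)=\mu^{(i)}(k)e^{\theta\cdot k}/\phi^{(i)}(e^\theta)$, where $e^\theta=(e^{\theta_1},\dots,e^{\theta_K})$. The function $\chi=(\chi_1,\dots,\chi_K)^{\intercal}:\mathbb{R}^K\to\mathbb{R}^K$ is $\chi_i(\theta)=\log\phi^{(i)}(e^\theta)-\theta_i$, and $\theta\sim_\Gamma\theta'$ means $\chi(\theta)-\chi(\theta')\in(\ker\Gamma)^\perp$. *)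

theory Defs
  imports "HOL-Probability.Probability"
begin

text \<open>
  The index set \<open>[K]\<close> of types is a finite type \<open>'k\<close>, so that \<open>\<int>\<^sub>+\<^sup>K\<close> is \<^typ>\<open>nat ^ 'k\<close> and
  a projection is a function \<open>\<mu> :: 'k \<Rightarrow> (nat ^ 'k) pmf\<close>.
\<close>

type_synonym 'k projection = "'k \<Rightarrow> (nat ^ 'k) pmf"

definition gf_term :: "(nat ^ 'k::finite) pmf \<Rightarrow> 'a::real_normed_field ^ 'k \<Rightarrow> nat ^ 'k \<Rightarrow> 'a"
  where "gf_term p x k = of_real (pmf p k) * (\<Prod>j\<in>UNIV. (x $ j) ^ (k $ j))"

definition gf :: "(nat ^ 'k::finite) pmf \<Rightarrow> 'a::real_normed_field ^ 'k \<Rightarrow> 'a"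
  where "gf p x = (\<Sum>\<^sub>\<infinity>k. gf_term p x k)"

definition mean_matrix :: "'k::finite projection \<Rightarrow> real ^ 'k ^ 'k"
  where "mean_matrix \<mu> = (\<chi> i j. \<Sum>\<^sub>\<infinity>z. real (z $ j) * pmf (\<mu> i) z)"


subsection \<open>Bienayme-Galton-Watson trees\<close>

text \<open>
  Vertices are Ulam-Harris words, read from right to left: \<open>(j, n) # u\<close> is the \<open>n\<close>-th child of
  type \<open>j\<close> of the vertex \<open>u\<close> (counting from 0), and \<open>[]\<close> is the root. Each word \<open>u\<close>
  carries an offspring vector \<open>\<xi> u\<close>, whether or not \<open>u\<close> belongs to the tree.
\<close>

type_synonym 'k vertex = "('k \<times> nat) list"

definition vertex_type :: "'k \<Rightarrow> 'k vertex \<Rightarrow> 'k"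
  where "vertex_type i u = (case u of [] \<Rightarrow> i | (j, n) # v \<Rightarrow> j)"

inductive_set bgw_tree :: "('k::finite vertex \<Rightarrow> nat ^ 'k) \<Rightarrow> 'k vertex set"
  for \<xi> :: "'k vertex \<Rightarrow> nat ^ 'k" where
  root: "[] \<in> bgw_tree \<xi>"
| child: "u \<in> bgw_tree \<xi> \<Longrightarrow> n < \<xi> u $ j \<Longrightarrow> (j, n) # u \<in> bgw_tree \<xi>"

definition offspring_measure ::
    "'k::finite projection \<Rightarrow> 'k \<Rightarrow> ('k vertex \<Rightarrow> nat ^ 'k) measure"
  where "offspring_measure \<mu> i = (\<Pi>\<^sub>M u\<in>UNIV. measure_pmf (\<mu> (vertex_type i u)))"

lemma sets_finite_bgw_tree:
  fixes \<mu> :: "'k::finite projection"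
  shows "{\<xi> \<in> space (offspring_measure \<mu> i). finite (bgw_tree \<xi>)} \<in> sets (offspring_measure \<mu> i)"
proof -
  let ?M = "offspring_measure \<mu> i"
  have comp: "Measurable.pred ?M (\<lambda>\<xi>. P (\<xi> u))" for u and P :: "nat ^ 'k \<Rightarrow> bool"
  proof -
    have "(\<lambda>\<xi>. \<xi> u) \<in> measurable ?M (measure_pmf (\<mu> (vertex_type i u)))"
      unfolding offspring_measure_def by (rule measurable_component_singleton) simp
    then show ?thesis
      by (rule measurable_compose) simp
  qed
  have mem: "Measurable.pred ?M (\<lambda>\<xi>. u \<in> bgw_tree \<xi>)" for u
  proof (induction u)
    case Nil
    then show ?case by (simp add: bgw_tree.root)
  next
    case (Cons a u)
    obtain j n where a: "a = (j, n)" by fastforce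
    have "(\<lambda>\<xi>. a # u \<in> bgw_tree \<xi>) = (\<lambda>\<xi>. u \<in> bgw_tree \<xi> \<and> n < \<xi> u $ j)"
      unfolding a by (intro ext) (auto intro: bgw_tree.child elim: bgw_tree.cases)
    then show ?case
      using Cons comp[where u=u and P="\<lambda>k. n < k $ j"] by simp
  qed
  have "finite (bgw_tree \<xi>) \<longleftrightarrow>
      (\<exists>F\<in>{F. finite F}. \<forall>u. u \<in> bgw_tree \<xi> \<longrightarrow> u \<in> F)" for \<xi> :: "'k vertex \<Rightarrow> nat ^ 'k"
    by (auto intro: finite_subset)
  moreover have "countable {F :: 'k vertex set. finite F}"
    by (rule countable_Collect_finite)
  then have "Measurable.pred ?M (\<lambda>\<xi>. \<exists>F\<in>{F. finite F}. \<forall>u. u \<in> bgw_tree \<xi> \<longrightarrow> u \<in> F)"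
    using mem by measurable
  ultimately show ?thesis
    by (simp add: pred_def)
qed


subsection \<open>Properties of projections\<close>

definition entire_fun :: "(complex ^ 'k::finite \<Rightarrow> complex) \<Rightarrow> bool"
  where "entire_fun f \<longleftrightarrow>
    (\<forall>x. \<exists>D. (f has_derivative D) (at x) \<and> (\<forall>c v. D (c *s v) = c * D v))"

text \<open>
  An infinite sum takes the value 0 where it does not converge, so convergence on all of
  \<open>\<complex>\<^sup>K\<close> is required explicitly.
\<close>

definition entire :: "'k::finite projection \<Rightarrow> bool"
  where "entire \<mu> \<longleftrightarrow>
    (\<forall>i. (\<forall>x :: complex ^ 'k. gf_term (\<mu> i) x summable_on UNIV) \<and>
         entire_fun (gf (\<mu> i)))"

definition finite_projection :: "'k::finite projection \<Rightarrow> bool"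
  where "finite_projection \<mu> \<longleftrightarrow>
    (\<forall>i. measure (offspring_measure \<mu> i)
           {\<xi> \<in> space (offspring_measure \<mu> i). finite (bgw_tree \<xi>)} > 0)"

definition nondegenerate :: "'k::finite projection \<Rightarrow> bool"
  where "nondegenerate \<mu> \<longleftrightarrow> (\<exists>i. measure_pmf.prob (\<mu> i) {z. (\<Sum>j\<in>UNIV. z $ j) \<ge> 2} > 0)"

definition nonlocalized :: "'k::finite projection \<Rightarrow> bool"
  where "nonlocalized \<mu> \<longleftrightarrow>
    (\<forall>X :: real ^ 'k. X \<noteq> 0 \<longrightarrow>
      (\<exists>i. \<not> (\<exists>c. AE k in measure_pmf (\<mu> i). (\<Sum>j\<in>UNIV. X $ j * real (k $ j)) = c)))"

text \<open>The power \<open>M ^ p\<close> of the library is taken entrywise, hence the explicit iteration of \<open>**\<close>.\<close>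

definition irreducible_projection :: "'k::finite projection \<Rightarrow> bool"
  where "irreducible_projection \<mu> \<longleftrightarrow>
    (\<forall>i j. \<exists>p\<ge>1. (((**) (mean_matrix \<mu>) ^^ p) (mat 1)) $ i $ j > 0)"

definition spectral_radius :: "real ^ 'k::finite ^ 'k \<Rightarrow> real"
  where "spectral_radius A =
    Max {cmod c | c. \<exists>v :: complex ^ 'k. v \<noteq> 0 \<and> map_matrix complex_of_real A *v v = c *s v}"

definition critical :: "'k::finite projection \<Rightarrow> bool"
  where "critical \<mu> \<longleftrightarrow> spectral_radius (mean_matrix \<mu>) = 1"


subsection \<open>Exponential tilting\<close>

definition exp_vec :: "real ^ 'k::finite \<Rightarrow> real ^ 'k"
  where "exp_vec \<theta> = (\<chi> j. exp (\<theta> $ j))"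

definition tilt :: "'k::finite projection \<Rightarrow> real ^ 'k \<Rightarrow> 'k projection"
  where "tilt \<mu> \<theta> i =
    embed_pmf (\<lambda>k. pmf (\<mu> i) k * exp (\<Sum>j\<in>UNIV. \<theta> $ j * real (k $ j)) / gf (\<mu> i) (exp_vec \<theta>))"

text \<open>
  For entire projections the tilted weights do form a probability distribution, so
  \<^const>\<open>embed_pmf\<close> is used within its domain.
\<close>

lemma pmf_tilt:
  fixes \<mu> :: "'k::finite projection"
  assumes "entire \<mu>"
  shows "pmf (tilt \<mu> \<theta> i) k =
    pmf (\<mu> i) k * exp (\<Sum>j\<in>UNIV. \<theta> $ j * real (k $ j)) / gf (\<mu> i) (exp_vec \<theta>)"
proof -
  define w where "w = gf_term (\<mu> i) (exp_vec \<theta>)"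
  have w_eq: "w k = pmf (\<mu> i) k * exp (\<Sum>j\<in>UNIV. \<theta> $ j * real (k $ j))" for k
    by (simp add: w_def gf_term_def exp_vec_def exp_sum flip: exp_of_nat2_mult)
  have w_nonneg: "w k \<ge> 0" for k
    by (simp add: w_eq)
  have "gf_term (\<mu> i) (\<chi> j. complex_of_real (exp (\<theta> $ j))) summable_on UNIV"
    using assms by (simp add: entire_def)
  moreover have "gf_term (\<mu> i) (\<chi> j. complex_of_real (exp (\<theta> $ j))) = (\<lambda>k. complex_of_real (w k))"
    by (auto simp: w_def gf_term_def exp_vec_def)
  ultimately have summable: "w summable_on UNIV"
    using summable_on_Re[of "\<lambda>k. complex_of_real (w k)" UNIV] by simp
  then have sums: "(w has_sum gf (\<mu> i) (exp_vec \<theta>)) UNIV"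
    by (simp add: gf_def w_def)
  obtain k0 where "k0 \<in> set_pmf (\<mu> i)"
    using set_pmf_not_empty by fastforce
  then have "w k0 > 0"
    by (simp add: w_eq pmf_positive)
  moreover have "sum w {k0} \<le> gf (\<mu> i) (exp_vec \<theta>)"
    using sums summable w_nonneg by (metis infsumI finite.emptyI finite.insertI
        finite_sum_le_infsum subset_UNIV)
  ultimately have pos: "gf (\<mu> i) (exp_vec \<theta>) > 0"
    by simp
  have abs: "(\<lambda>k. norm (w k)) summable_on UNIV"
    using summable w_nonneg by simp
  then have int: "integrable (count_space UNIV) w"
    using abs_summable_equivalent[of w UNIV] by (simp only: Infinite_Set_Sum.abs_summable_on_def)
  have "gf (\<mu> i) (exp_vec \<theta>) = integral\<^sup>L (count_space UNIV) w"
    using infsetsum_infsum[of w UNIV] int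
    by (simp add: infsetsum_def Infinite_Set_Sum.abs_summable_on_def gf_def w_def)
  then have "(\<integral>\<^sup>+k. ennreal (w k) \<partial>count_space UNIV) = ennreal (gf (\<mu> i) (exp_vec \<theta>))"
    using nn_integral_eq_integral[OF int] w_nonneg by simp
  then have "(\<integral>\<^sup>+k. ennreal (w k / gf (\<mu> i) (exp_vec \<theta>)) \<partial>count_space UNIV) = 1"
    using pos w_nonneg
    by (simp add: divide_ennreal[symmetric] nn_integral_divide ennreal_divide_self)
  then show ?thesis
    unfolding tilt_def w_eq using pos by (subst pmf_embed_pmf) auto
qed

definition chi :: "'k::finite projection \<Rightarrow> real ^ 'k \<Rightarrow> real ^ 'k"
  where "chi \<mu> \<theta> = (\<chi> i. ln (gf (\<mu> i) (exp_vec \<theta>)) - \<theta> $ i)"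

definition ker_real :: "int ^ 'k::finite ^ 'l::finite \<Rightarrow> (real ^ 'k) set"
  where "ker_real \<Gamma> = {X. map_matrix real_of_int \<Gamma> *v X = 0}"

definition tilt_equiv ::
    "'k::finite projection \<Rightarrow> int ^ 'k ^ 'l::finite \<Rightarrow> real ^ 'k \<Rightarrow> real ^ 'k \<Rightarrow> bool"
  where "tilt_equiv \<mu> \<Gamma> \<theta> \<theta>' \<longleftrightarrow> chi \<mu> \<theta> - chi \<mu> \<theta>' \<in> (ker_real \<Gamma>)\<^sup>\<bottom>"

end

theory Submission
  imports Defs
begin

text \<open>
  The function \<open>chi \<mu>\<close> is convex in each coordinate, vanishes at the origin, and its Jacobian at
  \<open>\<theta>\<close> is \<open>M\<^sub>\<theta> - I\<close>, where \<open>M\<^sub>\<theta>\<close> is the mean matrix of \<open>tilt \<mu> \<theta>\<close>. So if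
  \<open>a \<ge> 0\<close>, \<open>a \<noteq> 0\<close> and \<open>\<theta>\<close> minimises \<open>a \<bullet> chi \<mu>\<close>, then \<open>a\<close> is a left eigenvector of \<open>M\<^sub>\<theta>\<close> for
  the eigenvalue 1 (\<open>minimizer_left_eigenvector\<close>). Irreducibility makes all entries of \<open>a\<close> positive
  (\<open>left_eigenvector_pos\<close>), and a nonnegative matrix with a positive left eigenvector for the
  eigenvalue 1 has spectral radius 1 (\<open>spectral_radius_eq_1\<close>).

  It remains to find such a minimiser \<open>\<theta>\<close> with \<open>chi \<mu> \<theta>\<close> orthogonal to the kernel of \<open>\<Gamma>\<close>. Any
  nonzero row \<open>w\<close> of \<open>\<Gamma>\<close> is orthogonal to the kernel, so it suffices that \<open>chi \<mu> \<theta>\<close> lies on the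
  line \<open>\<real>w\<close>. The set \<open>S\<close> of all \<open>y\<close> with \<open>chi \<mu> \<theta> \<le> y\<close> for some \<open>\<theta>\<close> is convex, closed upwards
  and contains 0. If the line leaves \<open>S\<close>, say after \<open>tw \<in> S\<close>, then \<open>S\<close> has a supporting
  hyperplane at \<open>tw\<close>, with normal vector \<open>a \<ge> 0\<close>. Any \<open>\<theta>\<close> with \<open>chi \<mu> \<theta> \<le> tw\<close> minimises
  \<open>a \<bullet> chi \<mu>\<close>, and as \<open>a\<close> turns out to be positive, the inequality \<open>chi \<mu> \<theta> \<le> tw\<close> is an equality.

  Two facts make this work: a last point \<open>tw\<close> of \<open>S\<close> exists, and the line does leave \<open>S\<close>. Both are
  compactness arguments on the slopes of \<open>chi\<close> at infinity, where \<open>chi \<mu> \<theta> $ i\<close> grows at least like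
  \<open>\<theta> \<bullet> k - \<theta> $ i\<close> for every \<open>k\<close> in the support of \<open>\<mu> i\<close> (\<open>asymptotic_slope\<close>). An unbounded set
  of \<open>\<theta>\<close> with \<open>chi \<mu> \<theta> \<le> y\<close> would give a direction \<open>u \<noteq> 0\<close> with \<open>u \<bullet> k \<le> u $ i\<close> throughout,
  that is, a weighting of the types for which children together never weigh more than
  their parent. Finite trees force \<open>u \<ge> 0\<close>, irreducibility makes \<open>u\<close> constant, and an individual with two children makes
  it zero (\<open>superharmonic_zero\<close>). If the whole line lay in \<open>S\<close>, its two ends would
  give opposite directions \<open>u\<close> and \<open>-u\<close> for which \<open>u \<bullet> k\<close> is determined by the type of the
  parent, so \<open>u = 0\<close> by nonlocalization, and the slopes \<open>w $ i\<close> along \<open>u\<close> would all be zero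
  (\<open>no_line_of_sublevels\<close>).
\<close>

section \<open>Nonnegative matrices with a positive left eigenvector\<close>

lemma singular_iff_kernel:
  fixes A :: "'a::field ^ 'n ^ 'n"
  shows "det A = 0 \<longleftrightarrow> (\<exists>x. x \<noteq> 0 \<and> A *v x = 0)"
  by (metis invertible_det_nz invertible_left_inverse matrix_left_invertible_ker)

text \<open>
  The eigenvalues are roots of the characteristic polynomial, the determinant of a matrix with
  polynomial entries; a scalar that is not an eigenvalue shows that this polynomial is not zero.
\<close>

lemma finite_eigenvalues:
  fixes A :: "'a::field ^ 'n ^ 'n"
  assumes c0: "\<And>v. A *v v = c0 *s v \<Longrightarrow> v = 0"
  shows "finite {c. \<exists>v. v \<noteq> 0 \<and> A *v v = c *s v}"
proof -
  define q where "q = det (\<chi> i j. [:A $ i $ j:] - (if i = j then [:0, 1:] else 0))"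
  have poly_q: "poly q c = det (A - mat c)" for c
  proof -
    have "poly q c = (\<Sum>p | p permutes UNIV. of_int (sign p) *
        (\<Prod>i\<in>UNIV. A $ i $ p i - (if i = p i then c else 0)))"
      unfolding q_def det_def
      by (auto simp: poly_sum poly_prod of_int_poly intro!: sum.cong prod.cong)
    then show ?thesis
      by (simp add: det_def mat_def)
  qed
  have root: "(\<exists>v. v \<noteq> 0 \<and> A *v v = c *s v) \<longleftrightarrow> poly q c = 0" for c
  proof -
    have "mat c *v v = c *s v" for v :: "'a ^ 'n"
      by (simp add: vec_eq_iff matrix_vector_mult_def mat_def if_distrib[of "\<lambda>x. x * _"] cong: if_cong)
    then show ?thesis
      by (simp add: poly_q singular_iff_kernel matrix_vector_mult_diff_rdistrib)
  qed
  have "poly q c0 \<noteq> 0"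
    using c0 root by blast
  then have "q \<noteq> 0" by auto
  then show ?thesis
    unfolding root by (rule poly_roots_finite)
qed

text \<open>
  This is the part of the Perron-Frobenius theorem where the positive left eigenvector is given.
  The norm \<open>v \<mapsto> \<Sum>i. a i * \<bar>v i\<bar>\<close> does not increase under \<open>A\<close>, so all eigenvalues have
  modulus at most 1, and 1 is an eigenvalue because \<open>A\<close> and its transpose have the same ones. The
  spectral radius is the maximum of a set of reals, hence the appeal to finiteness.
\<close>

lemma spectral_radius_eq_1:
  fixes A :: "real ^ 'k::finite ^ 'k" and a :: "'k \<Rightarrow> real"
  assumes A: "\<And>i j. A $ i $ j \<ge> 0" and a: "\<And>i. a i > 0"
    and left: "\<And>j. (\<Sum>i\<in>UNIV. a i * A $ i $ j) = a j"
  shows "spectral_radius A = 1"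
proof -
  let ?B = "map_matrix complex_of_real A"
  let ?E = "{c. \<exists>v :: complex ^ 'k. v \<noteq> 0 \<and> ?B *v v = c *s v}"
  have le1: "cmod c \<le> 1" if v: "v \<noteq> 0" "?B *v v = c *s v" for c and v :: "complex ^ 'k"
  proof -
    let ?s = "\<Sum>j\<in>UNIV. a j * cmod (v $ j)"
    obtain i where "v $ i \<noteq> 0"
      using v(1) by (auto simp: vec_eq_iff)
    then have pos: "?s > 0"
      using a by (intro sum_pos2[of _ i]) (auto simp: less_imp_le)
    have "cmod c * cmod (v $ i) \<le> (\<Sum>j\<in>UNIV. A $ i $ j * cmod (v $ j))" for i
    proof -
      have "cmod c * cmod (v $ i) = cmod ((?B *v v) $ i)"
        using v(2) by (simp add: norm_mult)
      also have "\<dots> \<le> (\<Sum>j\<in>UNIV. cmod (?B $ i $ j * v $ j))"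
        unfolding matrix_vector_mult_def by (simp del: nth_map_matrix, rule norm_sum)
      finally show ?thesis
        using A by (simp add: norm_mult)
    qed
    then have "(\<Sum>i\<in>UNIV. a i * (cmod c * cmod (v $ i)))
        \<le> (\<Sum>i\<in>UNIV. a i * (\<Sum>j\<in>UNIV. A $ i $ j * cmod (v $ j)))"
      using a by (intro sum_mono mult_left_mono) (auto simp: less_imp_le)
    also have "\<dots> = (\<Sum>j\<in>UNIV. (\<Sum>i\<in>UNIV. a i * A $ i $ j) * cmod (v $ j))"
      unfolding sum_distrib_left sum_distrib_right by (subst sum.swap) (simp add: mult.assoc)
    finally have "cmod c * ?s \<le> 1 * ?s"
      by (simp add: left sum_distrib_left mult.left_commute)
    then show ?thesis
      using pos by (simp add: mult_le_cancel_right)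
  qed
  \<comment> \<open>By the bound just shown, 2 is not an eigenvalue.\<close>
  have "finite ?E"
    using le1[of _ 2] by (intro finite_eigenvalues[of _ 2]) fastforce
  moreover have one: "1 \<in> ?E"
  proof -
    have "(\<Sum>i\<in>UNIV. A $ i $ j * a i) = a j" for j
      using left[of j] by (simp add: mult.commute)
    then have "transpose (A - mat 1) *v vec_lambda a = 0"
      by (simp add: vec_eq_iff matrix_vector_mult_def transpose_def mat_def left_diff_distrib
          sum_subtractf if_distrib[of "\<lambda>x. x * _"] cong: if_cong)
    moreover have "vec_lambda a \<noteq> 0"
      using a by (metis less_irrefl vec_lambda_beta zero_index)
    ultimately have "det (A - mat 1) = 0"
      by (metis det_transpose singular_iff_kernel)
    then obtain x where x: "x \<noteq> 0" "A *v x = x"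
      using singular_iff_kernel[of "A - mat 1"] by (auto simp: matrix_vector_mult_diff_rdistrib)
    let ?x = "\<chi> i. complex_of_real (x $ i)"
    have "?B *v ?x = 1 *s ?x"
      using x(2) by (simp add: vec_eq_iff matrix_vector_mult_def flip: of_real_mult of_real_sum)
    moreover have "?x \<noteq> 0"
      using x(1) by (simp add: vec_eq_iff)
    ultimately show ?thesis by blast
  qed
  ultimately have "finite (cmod ` ?E)"
    by blast
  moreover have "1 \<in> cmod ` ?E"
    using imageI[OF one, of cmod] by (simp only: norm_one)
  moreover have "r \<le> 1" if "r \<in> cmod ` ?E" for r
    using that le1 by blast
  ultimately have "Max (cmod ` ?E) = 1"
    by (intro Max_eqI) auto
  moreover have "{cmod c | c. \<exists>v :: complex ^ 'k. v \<noteq> 0 \<and> ?B *v v = c *s v} = cmod ` ?E"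
    by blast
  ultimately show ?thesis
    by (simp only: spectral_radius_def)
qed

section \<open>The function chi\<close>

text \<open>
  This is \<open>\<theta> \<bullet> k\<close>, spelled out because offspring vectors have entries in the natural numbers.
\<close>

definition pairing :: "real ^ 'k::finite \<Rightarrow> nat ^ 'k \<Rightarrow> real"
  where "pairing \<theta> k = (\<Sum>j\<in>UNIV. \<theta> $ j * real (k $ j))"

lemma pairing_linear:
  "pairing 0 k = 0" "pairing (\<theta> + \<eta>) k = pairing \<theta> k + pairing \<eta> k"
  "pairing (\<theta> - \<eta>) k = pairing \<theta> k - pairing \<eta> k"
  "pairing (c *\<^sub>R \<theta>) k = c * pairing \<theta> k" "pairing (axis j 1) k = real (k $ j)"
  by (simp_all add: pairing_def distrib_right left_diff_distrib sum.distrib sum_subtractf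
      sum_distrib_left mult.assoc axis_def if_distrib[of "\<lambda>x. x * _"] cong: if_cong)

lemma tendsto_pairing:
  "(f \<longlongrightarrow> u) F \<Longrightarrow> ((\<lambda>n. pairing (f n) k) \<longlongrightarrow> pairing u k) F"
  unfolding pairing_def by (intro tendsto_intros)

text \<open>
  Substituting \<open>e\<^sup>\<theta>\<close> turns the generating function into the moment generating function at \<open>\<theta>\<close>.
  The sum converges for every \<open>\<theta>\<close> since the complex power series converges everywhere.
\<close>

lemma has_sum_mgf:
  assumes "entire \<mu>"
  shows "((\<lambda>k. pmf (\<mu> i) k * exp (pairing \<theta> k)) has_sum gf (\<mu> i) (exp_vec \<theta>)) UNIV"
proof -
  let ?w = "\<lambda>k. pmf (\<mu> i) k * exp (pairing \<theta> k)"
  have w: "gf_term (\<mu> i) (exp_vec \<theta>) = ?w"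
    by (simp add: fun_eq_iff gf_term_def exp_vec_def pairing_def exp_sum flip: exp_of_nat2_mult)
  have "gf_term (\<mu> i) (\<chi> j. complex_of_real (exp (\<theta> $ j))) summable_on UNIV"
    using assms by (simp add: entire_def)
  moreover have "gf_term (\<mu> i) (\<chi> j. complex_of_real (exp (\<theta> $ j))) =
      (\<lambda>k. complex_of_real (gf_term (\<mu> i) (exp_vec \<theta>) k))"
    by (auto simp: gf_term_def exp_vec_def)
  ultimately have "?w summable_on UNIV"
    using summable_on_Re[of "\<lambda>k. complex_of_real (?w k)" UNIV] by (simp only: w Re_complex_of_real)
  then show ?thesis
    by (simp add: gf_def w)
qed

lemma mgf_ge_term:
  assumes "entire \<mu>"
  shows "pmf (\<mu> i) k * exp (pairing \<theta> k) \<le> gf (\<mu> i) (exp_vec \<theta>)"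
  using finite_sum_le_has_sum[OF has_sum_mgf[OF assms, of i \<theta>], of "{k}"] by simp

lemma mgf_pos:
  assumes "entire \<mu>"
  shows "gf (\<mu> i) (exp_vec \<theta>) > 0"
proof -
  obtain k where "k \<in> set_pmf (\<mu> i)"
    using set_pmf_not_empty by fastforce
  then have "pmf (\<mu> i) k * exp (pairing \<theta> k) > 0"
    by (simp add: pmf_positive)
  with mgf_ge_term[OF assms, of i k \<theta>] show ?thesis
    by linarith
qed

text \<open>
  Keeping a single term of the generating function shows that \<open>chi\<close> lies above one affine function
  for each offspring vector in the support; these determine its growth at infinity.
\<close>

lemma chi_ge:
  assumes "entire \<mu>" "k \<in> set_pmf (\<mu> i)"
  shows "pairing \<theta> k + ln (pmf (\<mu> i) k) - \<theta> $ i \<le> chi \<mu> \<theta> $ i"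
proof -
  have p: "pmf (\<mu> i) k > 0"
    using assms(2) by (rule pmf_positive)
  then have "pairing \<theta> k + ln (pmf (\<mu> i) k) = ln (pmf (\<mu> i) k * exp (pairing \<theta> k))"
    by (simp add: ln_mult)
  also have "\<dots> \<le> ln (gf (\<mu> i) (exp_vec \<theta>))"
    using mgf_ge_term[OF assms(1), of i k \<theta>] p by (intro ln_mono) auto
  finally show ?thesis
    by (simp add: chi_def)
qed

lemma chi_zero:
  assumes "entire \<mu>"
  shows "chi \<mu> 0 = 0"
proof -
  have "(pmf (\<mu> i) has_sum gf (\<mu> i) (exp_vec 0)) UNIV" for i
    using has_sum_mgf[OF assms, of i 0] by (simp add: pairing_linear)
  moreover have "(pmf (\<mu> i) has_sum 1) UNIV" for i
  proof -
    have "pmf (\<mu> i) summable_on UNIV"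
      using pmf_abs_summable[of "\<mu> i" UNIV] by (simp flip: abs_summable_equivalent)
    moreover have "infsum (pmf (\<mu> i)) UNIV = 1"
      using infsetsum_pmf_eq_1[of "\<mu> i" UNIV] infsetsum_infsum[OF pmf_abs_summable, of "\<mu> i" UNIV]
      by simp
    ultimately show ?thesis
      by (metis has_sum_infsum)
  qed
  ultimately have "gf (\<mu> i) (exp_vec 0) = 1" for i
    using has_sum_unique by blast
  then show ?thesis
    by (simp add: chi_def vec_eq_iff)
qed

text \<open>
  The logarithm of the moment generating function is convex by Hoelder's inequality, which is here
  the convexity of \<open>exp\<close>, applied pointwise to the two exponents after subtracting the
  respective value of the logarithm, so that both exponentials have mean 1.
\<close>

lemma chi_convex:
  assumes \<mu>: "entire \<mu>"
  shows "convex_on UNIV (\<lambda>\<theta>. chi \<mu> \<theta> $ i)"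
proof (rule convex_onI)
  fix t :: real and \<theta> \<eta> :: "real ^ 'a"
  assume t: "0 < t" "t < 1"
  let ?\<zeta> = "(1 - t) *\<^sub>R \<theta> + t *\<^sub>R \<eta>"
  let ?L = "\<lambda>\<theta>. ln (gf (\<mu> i) (exp_vec \<theta>))"
  let ?c = "(1 - t) * ?L \<theta> + t * ?L \<eta>"
  note pos = mgf_pos[OF \<mu>]
  have "gf (\<mu> i) (exp_vec ?\<zeta>) \<le> exp ?c * ((1 - t) * 1 + t * 1)"
  proof (rule has_sum_mono)
    show "((\<lambda>k. pmf (\<mu> i) k * exp (pairing ?\<zeta> k)) has_sum gf (\<mu> i) (exp_vec ?\<zeta>)) UNIV"
      by (rule has_sum_mgf[OF \<mu>])
    have norm: "((\<lambda>k. pmf (\<mu> i) k * exp (pairing \<theta> k - ?L \<theta>)) has_sum 1) UNIV" for \<theta>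
      using has_sum_divide_const[OF has_sum_mgf[OF \<mu>, of i \<theta>], of "gf (\<mu> i) (exp_vec \<theta>)"]
        pos[of i \<theta>] by (simp add: exp_diff)
    show "((\<lambda>k. exp ?c * ((1 - t) * (pmf (\<mu> i) k * exp (pairing \<theta> k - ?L \<theta>)) +
        t * (pmf (\<mu> i) k * exp (pairing \<eta> k - ?L \<eta>)))) has_sum
        exp ?c * ((1 - t) * 1 + t * 1)) UNIV"
      by (intro has_sum_cmult_right has_sum_add norm)
    fix k
    have "exp (pairing ?\<zeta> k - ?c)
        = exp ((1 - t) *\<^sub>R (pairing \<theta> k - ?L \<theta>) + t *\<^sub>R (pairing \<eta> k - ?L \<eta>))"
      by (simp add: pairing_linear algebra_simps)
    also have "\<dots> \<le> (1 - t) * exp (pairing \<theta> k - ?L \<theta>) + t * exp (pairing \<eta> k - ?L \<eta>)"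
      using t by (intro convex_onD[OF exp_convex]) auto
    finally have "exp ?c * (pmf (\<mu> i) k * exp (pairing ?\<zeta> k - ?c)) \<le> exp ?c * (pmf (\<mu> i) k *
        ((1 - t) * exp (pairing \<theta> k - ?L \<theta>) + t * exp (pairing \<eta> k - ?L \<eta>)))"
      by (intro mult_left_mono) auto
    moreover have "exp ?c * (pmf (\<mu> i) k * exp (pairing ?\<zeta> k - ?c)) =
        pmf (\<mu> i) k * exp (pairing ?\<zeta> k)"
      by (simp add: exp_diff)
    ultimately show "pmf (\<mu> i) k * exp (pairing ?\<zeta> k) \<le>
        exp ?c * ((1 - t) * (pmf (\<mu> i) k * exp (pairing \<theta> k - ?L \<theta>)) +
        t * (pmf (\<mu> i) k * exp (pairing \<eta> k - ?L \<eta>)))"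
      by (simp only: distrib_left mult.left_commute)
  qed
  then have "gf (\<mu> i) (exp_vec ?\<zeta>) \<le> exp ?c"
    by simp
  then have "?L ?\<zeta> \<le> ?c"
    using pos[of i ?\<zeta>] by (metis ln_exp ln_mono)
  then show "chi \<mu> ?\<zeta> $ i \<le> (1 - t) * chi \<mu> \<theta> $ i + t * chi \<mu> \<eta> $ i"
    by (simp add: chi_def algebra_simps)
qed simp

text \<open>
  The tilted means are finite because \<open>x \<le> exp x\<close> bounds them by a value of the generating function.
\<close>

lemma mean_matrix_tilt_has_sum:
  assumes \<mu>: "entire \<mu>"
  shows "((\<lambda>k. real (k $ j) * pmf (tilt \<mu> \<theta> i) k) has_sum mean_matrix (tilt \<mu> \<theta>) $ i $ j) UNIV"
proof -
  let ?g = "gf (\<mu> i) (exp_vec \<theta>)"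
  have "(\<lambda>k. real (k $ j) * pmf (tilt \<mu> \<theta> i) k) summable_on UNIV"
  proof (rule summable_on_comparison_test)
    show "(\<lambda>k. pmf (\<mu> i) k * exp (pairing (\<theta> + axis j 1) k) / ?g) summable_on UNIV"
      using has_sum_divide_const[OF has_sum_mgf[OF \<mu>]] has_sum_imp_summable by blast
    fix k
    have "real (k $ j) \<le> exp (real (k $ j))"
      using exp_ge_add_one_self[of "real (k $ j)"] by linarith
    then have "real (k $ j) * (pmf (\<mu> i) k * exp (pairing \<theta> k) / ?g)
        \<le> exp (real (k $ j)) * (pmf (\<mu> i) k * exp (pairing \<theta> k) / ?g)"
      using mgf_pos[OF \<mu>, of i \<theta>] by (intro mult_right_mono) auto
    then show "real (k $ j) * pmf (tilt \<mu> \<theta> i) k \<le> pmf (\<mu> i) k * exp (pairing (\<theta> + axis j 1) k) / ?g"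
      by (simp add: pmf_tilt[OF \<mu>] pairing_linear exp_add ac_simps flip: pairing_def)
  qed simp
  then show ?thesis
    by (simp add: mean_matrix_def)
qed

text \<open>
  Up to the factor \<open>s\<^sup>2\<close>, the remainder is dominated uniformly in \<open>s\<close> by an exponential
  in \<open>x\<close>, whose mean is again a value of the moment generating function.
\<close>

lemma exp_quadratic_bound:
  fixes s x :: real
  assumes "\<bar>s\<bar> \<le> 1" "x \<ge> 0"
  shows "exp (s * x) \<le> 1 + s * x + s\<^sup>2 * exp (2 * x)"
proof -
  obtain t where t: "\<bar>t\<bar> \<le> \<bar>s * x\<bar>"
    and e: "exp (s * x) = (\<Sum>m<2. (s * x) ^ m / fact m) + exp t / fact 2 * (s * x) ^ 2"
    using Maclaurin_exp_le by blast
  have "\<bar>s * x\<bar> \<le> x"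
    using assms mult_right_mono[of "\<bar>s\<bar>" 1 x] by (simp add: abs_mult)
  with t have "exp t \<le> exp x"
    by simp
  moreover have "x\<^sup>2 / 2 \<le> exp x"
    using exp_lower_Taylor_quadratic[OF assms(2)] assms(2) by linarith
  ultimately have "exp t * (x\<^sup>2 / 2) \<le> exp x * exp x"
    by (intro mult_mono) auto
  then have "s\<^sup>2 * (exp t * (x\<^sup>2 / 2)) \<le> s\<^sup>2 * exp (2 * x)"
    by (intro mult_left_mono) (auto simp flip: exp_add)
  with e show ?thesis
    by (simp add: numeral_2_eq_2 power_mult_distrib algebra_simps)
qed

text \<open>
  The linear coefficient is the derivative of \<open>log \<phi>\<^sup>(\<^sup>i\<^sup>)(e\<^sup>\<theta>)\<close> in direction \<open>j\<close>. A one-sided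
  bound with quadratic error is enough to read off the first-order condition at a minimum, and it
  avoids differentiating the series.
\<close>

lemma log_mgf_quadratic_bound:
  assumes \<mu>: "entire \<mu>"
  shows "\<exists>C. \<forall>s. \<bar>s\<bar> \<le> 1 \<longrightarrow>
    ln (gf (\<mu> i) (exp_vec (\<theta> + s *\<^sub>R axis j 1)))
      \<le> ln (gf (\<mu> i) (exp_vec \<theta>)) + s * mean_matrix (tilt \<mu> \<theta>) $ i $ j + s\<^sup>2 * C"
proof (intro exI allI impI)
  fix s :: real
  assume s: "\<bar>s\<bar> \<le> 1"
  let ?g = "\<lambda>\<theta>. gf (\<mu> i) (exp_vec \<theta>)"
  let ?m = "mean_matrix (tilt \<mu> \<theta>) $ i $ j"
  let ?C = "?g (\<theta> + 2 *\<^sub>R axis j 1) / ?g \<theta>"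
  let ?p = "\<lambda>k. pmf (\<mu> i) k * exp (pairing \<theta> k)"
  note pos = mgf_pos[OF \<mu>]
  have "?g (\<theta> + s *\<^sub>R axis j 1) \<le> ?g \<theta> + s * (?g \<theta> * ?m) + s\<^sup>2 * ?g (\<theta> + 2 *\<^sub>R axis j 1)"
  proof (rule has_sum_mono)
    show "((\<lambda>k. pmf (\<mu> i) k * exp (pairing (\<theta> + s *\<^sub>R axis j 1) k)) has_sum
        ?g (\<theta> + s *\<^sub>R axis j 1)) UNIV"
      by (rule has_sum_mgf[OF \<mu>])
    show "((\<lambda>k. ?p k + s * (?g \<theta> * (real (k $ j) * pmf (tilt \<mu> \<theta> i) k)) +
        s\<^sup>2 * (pmf (\<mu> i) k * exp (pairing (\<theta> + 2 *\<^sub>R axis j 1) k))) has_sum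
        ?g \<theta> + s * (?g \<theta> * ?m) + s\<^sup>2 * ?g (\<theta> + 2 *\<^sub>R axis j 1)) UNIV"
      by (intro has_sum_add has_sum_cmult_right has_sum_mgf[OF \<mu>] mean_matrix_tilt_has_sum[OF \<mu>])
    fix k
    have "?p k * exp (s * real (k $ j))
        \<le> ?p k * (1 + s * real (k $ j) + s\<^sup>2 * exp (2 * real (k $ j)))"
      using exp_quadratic_bound[OF s] by (intro mult_left_mono) auto
    then show "pmf (\<mu> i) k * exp (pairing (\<theta> + s *\<^sub>R axis j 1) k)
        \<le> ?p k + s * (?g \<theta> * (real (k $ j) * pmf (tilt \<mu> \<theta> i) k)) +
          s\<^sup>2 * (pmf (\<mu> i) k * exp (pairing (\<theta> + 2 *\<^sub>R axis j 1) k))"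
      using pos[of i \<theta>]
      by (simp add: pmf_tilt[OF \<mu>] pairing_linear exp_add algebra_simps flip: pairing_def)
  qed
  also have "\<dots> = ?g \<theta> * (1 + (s * ?m + s\<^sup>2 * ?C))"
    using pos[of i \<theta>] by (simp add: field_simps)
  also have "\<dots> \<le> ?g \<theta> * exp (s * ?m + s\<^sup>2 * ?C)"
    using pos[of i \<theta>] exp_ge_add_one_self by (intro mult_left_mono) auto
  finally have "ln (?g (\<theta> + s *\<^sub>R axis j 1)) \<le> ln (?g \<theta> * exp (s * ?m + s\<^sup>2 * ?C))"
    using pos by (intro ln_mono) auto
  then show "ln (?g (\<theta> + s *\<^sub>R axis j 1)) \<le> ln (?g \<theta>) + s * ?m + s\<^sup>2 * ?C"
    using pos[of i \<theta>] by (simp add: ln_mult)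
qed

section \<open>Superharmonic weights on the types\<close>

text \<open>
  The usable form of irreducibility: a property inherited by children of every possible type, once
  it holds for one type, holds for all of them.
\<close>

lemma irreducible_propagates:
  assumes irr: "irreducible_projection \<mu>"
    and P: "P i" and step: "\<And>i j k. P i \<Longrightarrow> k \<in> set_pmf (\<mu> i) \<Longrightarrow> k $ j > 0 \<Longrightarrow> P j"
  shows "P j"
proof -
  let ?M = "mean_matrix \<mu>"
  have nonneg: "?M $ i $ j \<ge> 0" for i j
    by (simp add: mean_matrix_def infsum_nonneg)
  have edge: "P j" if "P i" "?M $ i $ j > 0" for i j
  proof -
    have "\<exists>k\<in>set_pmf (\<mu> i). k $ j > 0"
    proof (rule ccontr)
      assume "\<not> ?thesis"
      then have "real (k $ j) * pmf (\<mu> i) k = 0" for k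
        by (auto simp: set_pmf_iff)
      then have "?M $ i $ j = 0"
        by (simp add: mean_matrix_def infsum_0)
      with that show False by simp
    qed
    with step that(1) show ?thesis by blast
  qed
  have mult: "(A ** B) $ i $ j = (\<Sum>l\<in>UNIV. A $ i $ l * B $ l $ j)"
    for A B :: "real ^ 'a ^ 'a" and i j
    by (simp add: matrix_matrix_mult_def)
  have path: "P i \<Longrightarrow> (((**) ?M ^^ p) (mat 1)) $ i $ j > 0 \<Longrightarrow> P j" for p i
  proof (induction p arbitrary: i)
    case 0
    then show ?case by (simp add: mat_def split: if_splits)
  next
    case (Suc p)
    then have "(\<Sum>l\<in>UNIV. ?M $ i $ l * (((**) ?M ^^ p) (mat 1)) $ l $ j) > 0"
      by (simp add: mult)
    then obtain l where l: "?M $ i $ l * (((**) ?M ^^ p) (mat 1)) $ l $ j > 0"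
      by (meson not_less sum_nonpos)
    then have "?M $ i $ l > 0" "(((**) ?M ^^ p) (mat 1)) $ l $ j > 0"
      using nonneg[of i l] by (auto simp: zero_less_mult_iff)
    with Suc edge show ?case by blast
  qed
  obtain p where "(((**) ?M ^^ p) (mat 1)) $ i $ j > 0"
    using irr by (auto simp: irreducible_projection_def)
  with path P show ?thesis by blast
qed

text \<open>
  Since finite trees have positive probability, some finite tree has all its offspring vectors in
  the supports. In it a vertex weighs at least as much as its children together; leaves have
  weight at least 0, and so, going up the tree, does every vertex including the root.
\<close>

lemma superharmonic_nonneg:
  assumes fin: "finite_projection \<mu>"
    and u: "\<And>i k. k \<in> set_pmf (\<mu> i) \<Longrightarrow> pairing u k \<le> u $ i"
  shows "u $ i \<ge> 0"
proof -
  let ?O = "offspring_measure \<mu> i"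
  let ?F = "{\<xi> \<in> space ?O. finite (bgw_tree \<xi>)}"
  have supp: "AE \<xi> in ?O. \<forall>v. \<xi> v \<in> set_pmf (\<mu> (vertex_type i v))"
    unfolding AE_all_countable offspring_measure_def
  proof
    fix v
    show "AE \<xi> in PiM UNIV (\<lambda>v. measure_pmf (\<mu> (vertex_type i v))). \<xi> v \<in> set_pmf (\<mu> (vertex_type i v))"
      by (rule AE_PiM_component) (auto simp: AE_measure_pmf_iff measure_pmf.prob_space_axioms)
  qed
  have "\<exists>\<xi>. (\<forall>v. \<xi> v \<in> set_pmf (\<mu> (vertex_type i v))) \<and> \<xi> \<in> ?F"
  proof (rule ccontr)
    assume "\<not> ?thesis"
    then have "AE \<xi> in ?O. \<xi> \<notin> ?F"
      by (intro eventually_mono[OF supp]) blast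
    then have "emeasure ?O ?F = 0"
      by (subst (asm) AE_iff_measurable[OF sets_finite_bgw_tree]) auto
    moreover have "measure ?O ?F > 0"
      using fin unfolding finite_projection_def by (rule spec)
    ultimately show False
      by (simp add: measure_def)
  qed
  then obtain \<xi> where \<xi>: "\<And>v. \<xi> v \<in> set_pmf (\<mu> (vertex_type i v))"
      and tree: "finite (bgw_tree \<xi>)"
    by blast
  define N where "N = Max (length ` bgw_tree \<xi>)"
  have len: "length v \<le> N" if "v \<in> bgw_tree \<xi>" for v
    using that tree by (simp add: N_def)
  \<comment> \<open>Induction from the deepest vertices of the tree towards the root.\<close>
  have "u $ vertex_type i v \<ge> 0" if "v \<in> bgw_tree \<xi>" for v
    using that
  proof (induction "N - length v" arbitrary: v rule: less_induct)
    case less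
    have "u $ j * real (\<xi> v $ j) \<ge> 0" for j
    proof (cases "\<xi> v $ j = 0")
      case False
      then have child: "(j, 0) # v \<in> bgw_tree \<xi>"
        using less.prems by (intro bgw_tree.child) auto
      from less.hyps[OF _ child] len[OF child] have "u $ j \<ge> 0"
        by (simp add: vertex_type_def)
      then show ?thesis by simp
    qed simp
    then have "pairing u (\<xi> v) \<ge> 0"
      unfolding pairing_def by (intro sum_nonneg)
    with u[OF \<xi>, of v] show ?case
      by linarith
  qed
  from this[OF bgw_tree.root] show ?thesis
    by (simp add: vertex_type_def)
qed

text \<open>
  A nonnegative weight is at least the weight of any possible child type, so irreducibility makes
  \<open>u\<close> constant, and an individual with two children gives \<open>2 * u $ i \<le> u $ i\<close>.
\<close>

lemma superharmonic_zero:
  assumes fin: "finite_projection \<mu>" and nd: "nondegenerate \<mu>" and irr: "irreducible_projection \<mu>"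
    and u: "\<And>i k. k \<in> set_pmf (\<mu> i) \<Longrightarrow> pairing u k \<le> u $ i"
  shows "u = 0"
proof -
  note nonneg = superharmonic_nonneg[OF fin u]
  have edge: "u $ j \<le> u $ i" if "k \<in> set_pmf (\<mu> i)" "k $ j > 0" for i j k
  proof -
    have "u $ j * 1 \<le> u $ j * real (k $ j)"
      using nonneg that(2) by (intro mult_left_mono) auto
    also have "\<dots> \<le> pairing u k"
      unfolding pairing_def using nonneg by (intro member_le_sum) auto
    finally show ?thesis
      using u[OF that(1)] by simp
  qed
  have "u $ j \<le> u $ i" for i j
    by (rule irreducible_propagates[OF irr, where P="\<lambda>j. u $ j \<le> u $ i" and i=i])
      (use edge order_trans in blast)+
  then have const: "u $ j = u $ i" for i j
    by (simp add: order_antisym)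
  obtain i where "measure_pmf.prob (\<mu> i) {z. (\<Sum>j\<in>UNIV. z $ j) \<ge> 2} > 0"
    using nd by (auto simp: nondegenerate_def)
  then obtain k where k: "k \<in> set_pmf (\<mu> i)" "(\<Sum>j\<in>UNIV. k $ j) \<ge> 2"
    by (metis (no_types, lifting) disjoint_iff less_irrefl measure_pmf_zero_iff mem_Collect_eq)
  have "pairing u k = (\<Sum>j\<in>UNIV. u $ i * real (k $ j))"
    unfolding pairing_def by (intro sum.cong refl arg_cong2[of _ _ _ _ "(*)"] const)
  also have "\<dots> = u $ i * real (\<Sum>j\<in>UNIV. k $ j)"
    by (simp add: sum_distrib_left)
  finally have "u $ i * real (\<Sum>j\<in>UNIV. k $ j) \<le> u $ i"
    using u[OF k(1)] by simp
  moreover have "u $ i * 2 \<le> u $ i * real (\<Sum>j\<in>UNIV. k $ j)"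
    using k(2) nonneg by (intro mult_left_mono) linarith+
  ultimately have "u $ i = 0"
    using nonneg[of i] by linarith
  with const show ?thesis
    by (metis vec_eq_iff zero_index)
qed

section \<open>Sublevel sets of chi\<close>

definition sublevel :: "'k::finite projection \<Rightarrow> real ^ 'k \<Rightarrow> (real ^ 'k) set"
  where "sublevel \<mu> y = {\<theta>. \<forall>i. chi \<mu> \<theta> $ i \<le> y $ i}"

lemma sublevel_convex_combination:
  assumes \<mu>: "entire \<mu>" and "\<theta> \<in> sublevel \<mu> y" "\<eta> \<in> sublevel \<mu> z" "0 \<le> t" "t \<le> 1"
  shows "(1 - t) *\<^sub>R \<theta> + t *\<^sub>R \<eta> \<in> sublevel \<mu> ((1 - t) *\<^sub>R y + t *\<^sub>R z)"
proof -
  have "chi \<mu> ((1 - t) *\<^sub>R \<theta> + t *\<^sub>R \<eta>) $ i \<le> (1 - t) * y $ i + t * z $ i" for i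
  proof -
    have "chi \<mu> ((1 - t) *\<^sub>R \<theta> + t *\<^sub>R \<eta>) $ i \<le> (1 - t) * chi \<mu> \<theta> $ i + t * chi \<mu> \<eta> $ i"
      using assms(4,5) by (intro convex_onD[OF chi_convex[OF \<mu>]]) auto
    also have "\<dots> \<le> (1 - t) * y $ i + t * z $ i"
      using assms by (intro add_mono mult_left_mono) (auto simp: sublevel_def)
    finally show ?thesis .
  qed
  then show ?thesis by (simp add: sublevel_def)
qed

lemma zero_in_sublevel:
  assumes "entire \<mu>" "\<And>i. y $ i \<ge> 0"
  shows "0 \<in> sublevel \<mu> y"
  using assms by (simp add: sublevel_def chi_zero)

lemma sublevel_scale:
  assumes \<mu>: "entire \<mu>" and "\<theta> \<in> sublevel \<mu> y" "0 \<le> t" "t \<le> 1"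
  shows "t *\<^sub>R \<theta> \<in> sublevel \<mu> (t *\<^sub>R y)"
  using sublevel_convex_combination[OF \<mu> zero_in_sublevel[OF \<mu>] assms(2-4), of 0] by simp

text \<open>
  Divide \<open>chi_ge\<close> by \<open>r n\<close>: the logarithm of the weight of \<open>k\<close> disappears in the limit, and only
  the slope of the affine lower bound remains.
\<close>

lemma asymptotic_slope:
  fixes \<theta> y :: "nat \<Rightarrow> real ^ 'k::finite"
  assumes \<mu>: "entire \<mu>" and \<theta>: "\<And>n. \<theta> n \<in> sublevel \<mu> (y n)"
    and r: "filterlim r at_top sequentially"
    and u: "(\<lambda>n. \<theta> n /\<^sub>R r n) \<longlonglongrightarrow> u" and w: "(\<lambda>n. y n /\<^sub>R r n) \<longlonglongrightarrow> w"
    and k: "k \<in> set_pmf (\<mu> i)"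
  shows "pairing u k - u $ i \<le> w $ i"
proof (rule tendsto_le)
  show "(\<lambda>n. (y n /\<^sub>R r n) $ i) \<longlonglongrightarrow> w $ i"
    by (intro tendsto_vec_nth w)
  have "(\<lambda>n. inverse (r n)) \<longlonglongrightarrow> 0"
    by (rule tendsto_inverse_0_at_top[OF r])
  then have "(\<lambda>n. pairing (\<theta> n /\<^sub>R r n) k + inverse (r n) * ln (pmf (\<mu> i) k) - (\<theta> n /\<^sub>R r n) $ i)
      \<longlonglongrightarrow> pairing u k + 0 * ln (pmf (\<mu> i) k) - u $ i"
    by (intro tendsto_intros tendsto_pairing u)
  then show "(\<lambda>n. pairing (\<theta> n /\<^sub>R r n) k + inverse (r n) * ln (pmf (\<mu> i) k) - (\<theta> n /\<^sub>R r n) $ i)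
      \<longlonglongrightarrow> pairing u k - u $ i"
    by simp
  have "eventually (\<lambda>n. r n > 0) sequentially"
    using r by (simp add: filterlim_at_top_dense)
  then show "eventually (\<lambda>n. pairing (\<theta> n /\<^sub>R r n) k + inverse (r n) * ln (pmf (\<mu> i) k) -
      (\<theta> n /\<^sub>R r n) $ i \<le> (y n /\<^sub>R r n) $ i) sequentially"
  proof eventually_elim
    case (elim n)
    have "pairing (\<theta> n) k + ln (pmf (\<mu> i) k) - \<theta> n $ i \<le> y n $ i"
      using chi_ge[OF \<mu> k, of "\<theta> n"] \<theta>[of n] by (auto simp: sublevel_def intro: order_trans)
    then have "inverse (r n) * (pairing (\<theta> n) k + ln (pmf (\<mu> i) k) - \<theta> n $ i)
        \<le> inverse (r n) * y n $ i"
      using elim by (intro mult_left_mono) auto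
    then show ?case
      by (simp add: pairing_linear algebra_simps)
  qed
qed simp

text \<open>
  The normalised points of an unbounded sequence in the set accumulate at a unit vector along which
  every coordinate of \<open>chi\<close> has slope at most 0, which \<open>superharmonic_zero\<close> excludes.
\<close>

lemma bounded_sublevel:
  assumes \<mu>: "entire \<mu>" "finite_projection \<mu>" "nondegenerate \<mu>" "irreducible_projection \<mu>"
  shows "bounded (sublevel \<mu> y)"
proof (rule ccontr)
  assume "\<not> ?thesis"
  then have "\<exists>\<theta>\<in>sublevel \<mu> y. norm \<theta> > real n" for n
    by (auto simp: bounded_iff not_le)
  then obtain \<theta> where \<theta>: "\<And>n. \<theta> n \<in> sublevel \<mu> y" "\<And>n. norm (\<theta> n) > real n"
    by metis
  have nz: "\<theta> n \<noteq> 0" for n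
    using \<theta>(2)[of n] by auto
  have lim: "filterlim (\<lambda>n. norm (\<theta> n)) at_top sequentially"
    by (rule filterlim_at_top_mono[OF filterlim_real_sequentially])
      (use \<theta>(2) in \<open>auto intro!: always_eventually less_imp_le\<close>)
  have "\<theta> n /\<^sub>R norm (\<theta> n) \<in> sphere 0 1" for n
    using nz by simp
  then obtain u \<rho> where u: "u \<in> sphere 0 1" and \<rho>: "strict_mono \<rho>"
    and conv: "((\<lambda>n. \<theta> n /\<^sub>R norm (\<theta> n)) \<circ> \<rho>) \<longlonglongrightarrow> u"
    using compact_sphere[of "0 :: real ^ 'a" 1] unfolding compact_def by meson
  have lim': "filterlim (\<lambda>n. norm (\<theta> (\<rho> n))) at_top sequentially"
    by (rule filterlim_compose[OF lim filterlim_subseq[OF \<rho>]])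
  have "(\<lambda>n. inverse (norm (\<theta> (\<rho> n))) *\<^sub>R y) \<longlonglongrightarrow> 0 *\<^sub>R y"
    by (intro tendsto_intros tendsto_inverse_0_at_top[OF lim'])
  then have "(\<lambda>n. y /\<^sub>R norm (\<theta> (\<rho> n))) \<longlonglongrightarrow> 0"
    by simp
  with conv have "pairing u k - u $ i \<le> 0 $ i" if "k \<in> set_pmf (\<mu> i)" for i k
    by (intro asymptotic_slope[OF \<mu>(1) _ lim' _ _ that, of "\<theta> \<circ> \<rho>" "\<lambda>_. y"])
      (simp_all add: \<theta> o_def)
  then have "u = 0"
    by (intro superharmonic_zero[OF \<mu>(2-4)]) simp
  with u show False by simp
qed

lemma continuous_on_chi:
  assumes "entire \<mu>"
  shows "continuous_on UNIV (\<lambda>\<theta>. chi \<mu> \<theta> $ i)"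
  by (rule convex_on_continuous[OF open_UNIV chi_convex[OF assms]])

lemma compact_sublevel:
  assumes "entire \<mu>" "finite_projection \<mu>" "nondegenerate \<mu>" "irreducible_projection \<mu>"
  shows "compact (sublevel \<mu> y)"
proof -
  have "closed (sublevel \<mu> y)"
    unfolding sublevel_def
    by (intro closed_Collect_all closed_Collect_le continuous_on_chi[OF assms(1)] continuous_on_const)
  with bounded_sublevel[OF assms] show ?thesis
    by (simp add: compact_eq_bounded_closed)
qed

text \<open>
  By convexity, points \<open>\<theta> n\<close> and \<open>\<eta> n\<close> of the sublevel sets at \<open>n w\<close> and \<open>-n w\<close>, divided by
  \<open>n\<close>, stay in the compact sublevel sets at \<open>w\<close> and \<open>-w\<close>. Limits \<open>u\<close> and \<open>v\<close> of a common
  subsequence have slopes at most \<open>w\<close> and \<open>-w\<close>, so \<open>u + v\<close> has slope at most 0 and vanishes. Both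
  slope bounds are then equalities: the pairing of \<open>u\<close> with an offspring vector depends only on the
  type of the parent. Nonlocalization gives \<open>u = 0\<close>, and then all slopes \<open>w $ i\<close> are zero.
\<close>

lemma no_line_of_sublevels:
  assumes \<mu>: "entire \<mu>" "finite_projection \<mu>" "nondegenerate \<mu>" "irreducible_projection \<mu>"
    and nl: "nonlocalized \<mu>"
    and line: "\<And>t. sublevel \<mu> (t *\<^sub>R w) \<noteq> {}"
  shows "w = 0"
proof -
  have "\<exists>\<theta> \<eta>. \<theta> \<in> sublevel \<mu> (real (Suc n) *\<^sub>R w) \<and> \<eta> \<in> sublevel \<mu> (real (Suc n) *\<^sub>R - w)" for n
    using line[of "real (Suc n)"] line[of "- real (Suc n)"]
    by (metis all_not_in_conv scaleR_minus_left scaleR_minus_right)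
  then obtain \<theta> \<eta> where \<theta>: "\<And>n. \<theta> n \<in> sublevel \<mu> (real (Suc n) *\<^sub>R w)"
    and \<eta>: "\<And>n. \<eta> n \<in> sublevel \<mu> (real (Suc n) *\<^sub>R - w)"
    by metis
  have scale: "\<theta> /\<^sub>R real (Suc n) \<in> sublevel \<mu> w" if "\<theta> \<in> sublevel \<mu> (real (Suc n) *\<^sub>R w)" for \<theta> w n
    using sublevel_scale[OF \<mu>(1) that, of "inverse (real (Suc n))"] by (simp add: inverse_le_1_iff)
  have "compact (sublevel \<mu> w \<times> sublevel \<mu> (- w))"
    by (intro compact_Times compact_sublevel \<mu>)
  moreover have "(\<theta> n /\<^sub>R real (Suc n), \<eta> n /\<^sub>R real (Suc n)) \<in> sublevel \<mu> w \<times> sublevel \<mu> (- w)" for n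
    using scale[OF \<theta>] scale[OF \<eta>] by simp
  ultimately obtain l \<rho> where \<rho>: "strict_mono \<rho>"
    and conv: "((\<lambda>n. (\<theta> n /\<^sub>R real (Suc n), \<eta> n /\<^sub>R real (Suc n))) \<circ> \<rho>) \<longlonglongrightarrow> l"
    unfolding compact_def by meson
  have u: "(\<lambda>n. \<theta> (\<rho> n) /\<^sub>R real (Suc (\<rho> n))) \<longlonglongrightarrow> fst l"
    and v: "(\<lambda>n. \<eta> (\<rho> n) /\<^sub>R real (Suc (\<rho> n))) \<longlonglongrightarrow> snd l"
    using tendsto_fst[OF conv] tendsto_snd[OF conv] by (simp_all add: o_def)
  have lim: "filterlim (\<lambda>n. real (Suc (\<rho> n))) at_top sequentially"
    by (intro filterlim_compose[OF filterlim_real_sequentially]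
        filterlim_compose[OF filterlim_Suc] filterlim_subseq \<rho>)
  have slope_u: "pairing (fst l) k - fst l $ i \<le> w $ i" if "k \<in> set_pmf (\<mu> i)" for i k
    by (rule asymptotic_slope[OF \<mu>(1) \<theta> lim u _ that]) simp
  have slope_v: "pairing (snd l) k - snd l $ i \<le> (- w) $ i" if "k \<in> set_pmf (\<mu> i)" for i k
    by (rule asymptotic_slope[OF \<mu>(1) \<eta> lim v _ that]) simp
  have "fst l + snd l = 0"
    by (rule superharmonic_zero[OF \<mu>(2-4)])
      (use slope_u slope_v in \<open>fastforce simp: pairing_linear\<close>)
  then have snd: "snd l = - 1 *\<^sub>R fst l"
    by (simp add: add_eq_0_iff)
  have eq: "pairing (fst l) k = fst l $ i + w $ i" if "k \<in> set_pmf (\<mu> i)" for i k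
    using slope_u[OF that] slope_v[OF that] unfolding snd pairing_linear by simp
  then have "\<exists>c. AE k in measure_pmf (\<mu> i). (\<Sum>j\<in>UNIV. fst l $ j * real (k $ j)) = c" for i
    by (auto simp: AE_measure_pmf_iff pairing_def)
  with nl have l0: "fst l = 0"
    unfolding nonlocalized_def by blast
  have "w $ i = 0" for i
  proof -
    obtain k where "k \<in> set_pmf (\<mu> i)"
      using set_pmf_not_empty by fastforce
    from eq[OF this] show ?thesis
      by (simp add: l0 pairing_linear)
  qed
  then show ?thesis by (simp add: vec_eq_iff)
qed

section \<open>The boundary point on a line\<close>

text \<open>
  The pairs \<open>(t, \<theta>)\<close> with \<open>t \<ge> 0\<close> and \<open>chi \<mu> \<theta> \<le> t w\<close> form a compact set: by convexity \<open>t\<close> is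
  bounded by \<open>t1\<close>, so all these \<open>\<theta>\<close> lie in a single sublevel set.
\<close>

lemma last_sublevel_on_ray:
  assumes \<mu>: "entire \<mu>" "finite_projection \<mu>" "nondegenerate \<mu>" "irreducible_projection \<mu>"
    and empty: "sublevel \<mu> (t1 *\<^sub>R w) = {}" and t1: "t1 \<ge> 0"
  obtains t \<theta> where "\<theta> \<in> sublevel \<mu> (t *\<^sub>R w)" "\<And>s. s > t \<Longrightarrow> sublevel \<mu> (s *\<^sub>R w) = {}"
proof -
  have below: "t < t1" if "\<theta> \<in> sublevel \<mu> (t *\<^sub>R w)" for t \<theta>
  proof (rule ccontr)
    assume "\<not> t < t1"
    then have "t > 0 \<or> t1 = t" "t1 / t \<le> 1"
      using t1 by (auto simp: divide_le_eq_1)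
    moreover have "t1 \<noteq> t"
      using that empty by auto
    ultimately show False
      using sublevel_scale[OF \<mu>(1) that, of "t1 / t"] t1 empty by auto
  qed
  define K where "K = {p. 0 \<le> fst p \<and> fst p \<le> t1 \<and> (\<forall>i. chi \<mu> (snd p) $ i \<le> fst p * w $ i)}"
  have K_iff: "(t, \<theta>) \<in> K \<longleftrightarrow> 0 \<le> t \<and> t \<le> t1 \<and> \<theta> \<in> sublevel \<mu> (t *\<^sub>R w)" for t \<theta>
    by (auto simp: K_def sublevel_def)
  have "closed K"
    unfolding K_def
    by (intro closed_Collect_conj closed_Collect_all closed_Collect_le continuous_intros
        continuous_on_compose2[OF continuous_on_chi[OF \<mu>(1)]]) auto
  moreover have "K \<subseteq> {0..t1} \<times> sublevel \<mu> (t1 *\<^sub>R (\<chi> i. \<bar>w $ i\<bar>))"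
  proof clarify
    fix t \<theta> assume K: "(t, \<theta>) \<in> K"
    have "t * w $ i \<le> t1 * \<bar>w $ i\<bar>" for i
    proof -
      have "t * w $ i \<le> t * \<bar>w $ i\<bar>"
        using K by (intro mult_left_mono) (auto simp: K_iff)
      also have "\<dots> \<le> t1 * \<bar>w $ i\<bar>"
        using K by (intro mult_right_mono) (auto simp: K_iff)
      finally show ?thesis .
    qed
    with K show "t \<in> {0..t1} \<and> \<theta> \<in> sublevel \<mu> (t1 *\<^sub>R (\<chi> i. \<bar>w $ i\<bar>))"
      by (auto simp: K_iff sublevel_def intro: order_trans)
  qed
  moreover have "compact ({0..t1} \<times> sublevel \<mu> (t1 *\<^sub>R (\<chi> i. \<bar>w $ i\<bar>)))"
    by (intro compact_Times compact_sublevel \<mu>) auto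
  ultimately have "compact K"
    by (metis closed_Int_compact Int_absorb2)
  moreover have "(0, 0) \<in> K"
    using t1 by (simp add: K_iff zero_in_sublevel[OF \<mu>(1)])
  then have "K \<noteq> {}" by blast
  moreover have "continuous_on K fst"
    by (intro continuous_intros)
  ultimately obtain p where p: "p \<in> K" "\<And>q. q \<in> K \<Longrightarrow> fst q \<le> fst p"
    using continuous_attains_sup by metis
  show thesis
  proof
    show "snd p \<in> sublevel \<mu> (fst p *\<^sub>R w)"
      using p(1) K_iff[of "fst p" "snd p"] by simp
    show "sublevel \<mu> (s *\<^sub>R w) = {}" if "s > fst p" for s
    proof (rule ccontr)
      assume "sublevel \<mu> (s *\<^sub>R w) \<noteq> {}"
      then obtain \<eta> where \<eta>: "\<eta> \<in> sublevel \<mu> (s *\<^sub>R w)" by blast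
      with below[OF \<eta>] that p(1) have "(s, \<eta>) \<in> K"
        using K_iff[of "fst p" "snd p"] by (simp add: K_iff)
      from p(2)[OF this] that show False by simp
    qed
  qed
qed

text \<open>
  The ray of the points \<open>s w\<close> with \<open>s > t\<close> is separated from the set of all \<open>y\<close> with a nonempty
  sublevel set. This set is closed upwards, so the normal vector has no negative entry. Its
  points \<open>chi \<mu> \<eta>\<close> lie on one side of the hyperplane and \<open>t w\<close>, a limit of the ray, on the other,
  while \<open>chi \<mu> \<theta> \<le> t w\<close> gives the remaining inequality.
\<close>

lemma supporting_functional:
  fixes w :: "real ^ 'k::finite"
  assumes \<mu>: "entire \<mu>" and \<theta>: "\<theta> \<in> sublevel \<mu> (t *\<^sub>R w)"
    and last: "\<And>s. s > t \<Longrightarrow> sublevel \<mu> (s *\<^sub>R w) = {}"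
  obtains a where "a \<noteq> 0" "\<And>i. a $ i \<ge> 0" "a \<bullet> chi \<mu> \<theta> = a \<bullet> (t *\<^sub>R w)"
    "\<And>\<eta>. a \<bullet> chi \<mu> \<theta> \<le> a \<bullet> chi \<mu> \<eta>"
proof -
  let ?R = "(\<lambda>s. s *\<^sub>R w) ` {t<..}"
  let ?S = "{y. sublevel \<mu> y \<noteq> {}}"
  have "convex ?R"
    by (intro convex_linear_image linear_scaleR_left convex_real_interval)
  moreover have "convex ?S"
    unfolding convex_alt using sublevel_convex_combination[OF \<mu>] by fast
  moreover have "?R \<noteq> {}" "?S \<noteq> {}"
    using \<theta> by auto
  moreover have "?R \<inter> ?S = {}"
    using last by auto
  ultimately obtain a b where a: "a \<noteq> 0" and R: "\<And>y. y \<in> ?R \<Longrightarrow> a \<bullet> y \<le> b"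
    and S: "\<And>y. y \<in> ?S \<Longrightarrow> a \<bullet> y \<ge> b"
    using separating_hyperplane_sets[of ?R ?S] by blast
  have nonneg: "a $ i \<ge> 0" for i
  proof (rule ccontr)
    assume neg: "\<not> a $ i \<ge> 0"
    \<comment> \<open>A nonnegative multiple of the basis vector on which the functional takes the value \<open>-\<bar>b\<bar> - 1 < b\<close>.\<close>
    let ?s = "(\<bar>b\<bar> + 1) / (- a $ i)"
    have "?s \<ge> 0"
      using neg by (intro divide_nonneg_nonneg) auto
    then have "0 \<in> sublevel \<mu> (?s *\<^sub>R axis i 1)"
      by (intro zero_in_sublevel \<mu>) (simp add: axis_def del: divide_minus_right)
    then have "?s *\<^sub>R axis i 1 \<in> ?S"
      by blast
    from S[OF this] neg show False
      by (simp add: inner_axis)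
  qed
  have "((\<lambda>s. a \<bullet> (s *\<^sub>R w)) \<longlongrightarrow> a \<bullet> (t *\<^sub>R w)) (at_right t)"
    by (intro tendsto_intros)
  moreover have "eventually (\<lambda>s. a \<bullet> (s *\<^sub>R w) \<le> b) (at_right t)"
    using eventually_at_right_less[of t] by eventually_elim (rule R, blast)
  ultimately have ray: "a \<bullet> (t *\<^sub>R w) \<le> b"
    by (intro tendsto_upperbound) auto
  have low: "b \<le> a \<bullet> chi \<mu> \<eta>" for \<eta>
    by (rule S) (auto simp: sublevel_def)
  have "a \<bullet> chi \<mu> \<theta> \<le> a \<bullet> (t *\<^sub>R w)"
    using \<theta> nonneg unfolding inner_vec_def sublevel_def
    by (intro sum_mono) (auto intro: mult_left_mono)
  with ray low show thesis
    by (intro that[OF a nonneg]) (auto intro: order_antisym order_trans)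
qed

section \<open>Minimisers and criticality\<close>

lemma quadratic_nonneg_imp_linear_zero:
  fixes D C :: real
  assumes "\<And>s. \<bar>s\<bar> \<le> 1 \<Longrightarrow> 0 \<le> s * D + s\<^sup>2 * C"
  shows "D = 0"
proof (rule ccontr)
  assume D: "D \<noteq> 0"
  \<comment> \<open>At \<open>s = - D / B\<close> the linear term outweighs the quadratic one, and \<open>\<bar>s\<bar> \<le> 1\<close>.\<close>
  define B where "B = \<bar>C\<bar> + \<bar>D\<bar> + 1"
  have B: "B > 0" "C < B" "\<bar>D\<bar> \<le> B"
    by (auto simp: B_def)
  have "0 \<le> (- D / B) * D + (- D / B)\<^sup>2 * C"
    using B by (intro assms) (simp add: abs_divide)
  also have "\<dots> = (D / B)\<^sup>2 * (C - B)"
    using B by (simp add: field_simps power2_eq_square)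
  also have "\<dots> < 0"
    using B D by (intro mult_pos_neg) auto
  finally show False by simp
qed

text \<open>
  This is the vanishing of the partial derivative of \<open>a \<bullet> chi \<mu>\<close> in direction \<open>j\<close>.
\<close>

lemma minimizer_left_eigenvector:
  assumes \<mu>: "entire \<mu>" and a: "\<And>i. a $ i \<ge> 0"
    and min: "\<And>\<eta>. a \<bullet> chi \<mu> \<theta> \<le> a \<bullet> chi \<mu> \<eta>"
  shows "(\<Sum>i\<in>UNIV. a $ i * mean_matrix (tilt \<mu> \<theta>) $ i $ j) = a $ j"
proof -
  let ?m = "\<lambda>i. mean_matrix (tilt \<mu> \<theta>) $ i $ j"
  let ?L = "\<lambda>\<theta> i. ln (gf (\<mu> i) (exp_vec \<theta>))"
  have "\<exists>C. \<forall>i s. \<bar>s\<bar> \<le> 1 \<longrightarrow>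
      ?L (\<theta> + s *\<^sub>R axis j 1) i \<le> ?L \<theta> i + s * ?m i + s\<^sup>2 * C i"
    using log_mgf_quadratic_bound[OF \<mu>] by (intro choice) blast
  then obtain C where C: "\<And>i s. \<bar>s\<bar> \<le> 1 \<Longrightarrow>
      ?L (\<theta> + s *\<^sub>R axis j 1) i \<le> ?L \<theta> i + s * ?m i + s\<^sup>2 * C i"
    by blast
  have inner: "a \<bullet> chi \<mu> \<theta> = (\<Sum>i\<in>UNIV. a $ i * ?L \<theta> i) - a \<bullet> \<theta>" for \<theta>
    by (simp add: inner_vec_def chi_def right_diff_distrib sum_subtractf)
  have "(\<Sum>i\<in>UNIV. a $ i * ?m i) - a $ j = 0"
  proof (rule quadratic_nonneg_imp_linear_zero)
    fix s :: real assume s: "\<bar>s\<bar> \<le> 1"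
    have "a \<bullet> chi \<mu> \<theta> \<le> (\<Sum>i\<in>UNIV. a $ i * ?L (\<theta> + s *\<^sub>R axis j 1) i) - (a \<bullet> \<theta> + s * a $ j)"
      using min[of "\<theta> + s *\<^sub>R axis j 1"] by (simp add: inner inner_add_right inner_axis)
    also have "\<dots> \<le> (\<Sum>i\<in>UNIV. a $ i * (?L \<theta> i + s * ?m i + s\<^sup>2 * C i)) - (a \<bullet> \<theta> + s * a $ j)"
      using a C[OF s] by (intro diff_right_mono sum_mono mult_left_mono) auto
    also have "\<dots> = a \<bullet> chi \<mu> \<theta> + s * ((\<Sum>i\<in>UNIV. a $ i * ?m i) - a $ j) +
        s\<^sup>2 * (\<Sum>i\<in>UNIV. a $ i * C i)"
      by (simp add: inner distrib_left sum.distrib sum_distrib_left right_diff_distrib mult.left_commute)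
    finally show "0 \<le> s * ((\<Sum>i\<in>UNIV. a $ i * ?m i) - a $ j) + s\<^sup>2 * (\<Sum>i\<in>UNIV. a $ i * C i)"
      by simp
  qed
  then show ?thesis by simp
qed

text \<open>
  Tilting keeps the supports, so every possible child type of a type with positive entry has a
  positive entry, too.
\<close>

lemma left_eigenvector_pos:
  assumes \<mu>: "entire \<mu>" "irreducible_projection \<mu>" and a: "\<And>i. a i \<ge> 0" "a i0 > 0"
    and left: "\<And>j. (\<Sum>i\<in>UNIV. a i * mean_matrix (tilt \<mu> \<theta>) $ i $ j) = a j"
  shows "a j > 0"
proof (rule irreducible_propagates[OF \<mu>(2), where P="\<lambda>i. a i > 0", OF a(2)])
  fix i j k
  assume i: "a i > 0" and k: "k \<in> set_pmf (\<mu> i)" "k $ j > 0"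
  let ?M = "mean_matrix (tilt \<mu> \<theta>)"
  have nonneg: "?M $ i $ j \<ge> 0" for i j
    by (simp add: mean_matrix_def infsum_nonneg)
  have "0 < real (k $ j) * pmf (tilt \<mu> \<theta> i) k"
    using k mgf_pos[OF \<mu>(1), of i \<theta>] by (simp add: pmf_tilt[OF \<mu>(1)] pmf_positive)
  also have "\<dots> \<le> ?M $ i $ j"
    using finite_sum_le_has_sum[OF mean_matrix_tilt_has_sum[OF \<mu>(1)], of "{k}"] by simp
  finally have "0 < a i * ?M $ i $ j"
    using i by simp
  also have "\<dots> \<le> (\<Sum>i\<in>UNIV. a i * ?M $ i $ j)"
    using a(1) nonneg by (intro member_le_sum) auto
  finally show "a j > 0"
    by (simp add: left)
qed

lemma critical_tilt_on_line:
  assumes \<mu>: "entire \<mu>" "finite_projection \<mu>" "nondegenerate \<mu>" "irreducible_projection \<mu>"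
    and empty: "sublevel \<mu> (t1 *\<^sub>R w) = {}" and t1: "t1 \<ge> 0"
  shows "\<exists>\<theta> t. chi \<mu> \<theta> = t *\<^sub>R w \<and> critical (tilt \<mu> \<theta>)"
proof -
  obtain t \<theta> where \<theta>: "\<theta> \<in> sublevel \<mu> (t *\<^sub>R w)"
    and last: "\<And>s. s > t \<Longrightarrow> sublevel \<mu> (s *\<^sub>R w) = {}"
    using last_sublevel_on_ray[OF assms] by blast
  obtain a where a: "a \<noteq> 0" "\<And>i. a $ i \<ge> 0" and eq: "a \<bullet> chi \<mu> \<theta> = a \<bullet> (t *\<^sub>R w)"
    and min: "\<And>\<eta>. a \<bullet> chi \<mu> \<theta> \<le> a \<bullet> chi \<mu> \<eta>"
    using supporting_functional[OF \<mu>(1) \<theta> last] by blast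
  note left = minimizer_left_eigenvector[OF \<mu>(1) a(2) min]
  obtain i0 where "a $ i0 \<noteq> 0"
    using a(1) by (auto simp: vec_eq_iff)
  with a(2)[of i0] have "a $ i0 > 0"
    by simp
  from left_eigenvector_pos[OF \<mu>(1,4) a(2) this left] have pos: "a $ i > 0" for i .
  \<comment> \<open>The nonnegative gaps between \<open>t w\<close> and \<open>chi \<mu> \<theta>\<close> have weighted sum 0 with positive weights.\<close>
  have "(\<Sum>i\<in>UNIV. a $ i * ((t *\<^sub>R w) $ i - chi \<mu> \<theta> $ i)) = 0"
    using eq by (simp add: inner_vec_def right_diff_distrib sum_subtractf)
  moreover have "0 \<le> a $ i * ((t *\<^sub>R w) $ i - chi \<mu> \<theta> $ i)" for i
    using \<theta> a(2) by (simp add: sublevel_def)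
  ultimately have "a $ i * ((t *\<^sub>R w) $ i - chi \<mu> \<theta> $ i) = 0" for i
    using sum_nonneg_eq_0_iff[of UNIV "\<lambda>i. a $ i * ((t *\<^sub>R w) $ i - chi \<mu> \<theta> $ i)"] by simp
  with pos have "chi \<mu> \<theta> = t *\<^sub>R w"
    by (metis diff_eq_diff_eq diff_self less_irrefl mult_eq_0_iff vec_eq_iff)
  moreover have "critical (tilt \<mu> \<theta>)"
    unfolding critical_def
    by (rule spectral_radius_eq_1[OF _ pos left]) (simp add: mean_matrix_def infsum_nonneg)
  ultimately show ?thesis by blast
qed

theorem corollary3p8:
  fixes \<mu> :: "'k::finite projection"
    and \<Gamma> :: "int ^ 'k ^ 'l::finite"
  assumes "entire \<mu>"
    and "finite_projection \<mu>"
    and "nondegenerate \<mu>"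
    and "nonlocalized \<mu>"
    and "irreducible_projection \<mu>"
    and "\<Gamma> \<noteq> 0"
  shows "\<exists>\<theta> :: real ^ 'k. tilt_equiv \<mu> \<Gamma> \<theta> 0 \<and> critical (tilt \<mu> \<theta>)"
proof -
  note \<mu> = assms(1,2,3,5)
  obtain r where r: "\<Gamma> $ r \<noteq> 0"
    using assms(6) by (auto simp: vec_eq_iff)
  define w where "w = map_matrix real_of_int \<Gamma> $ r"
  have "w \<noteq> 0"
    using r by (simp add: w_def vec_eq_iff)
  then obtain t where empty: "sublevel \<mu> (t *\<^sub>R w) = {}"
    using no_line_of_sublevels[OF \<mu> assms(4)] by blast
  have "\<exists>\<theta> t. chi \<mu> \<theta> = t *\<^sub>R w \<and> critical (tilt \<mu> \<theta>)"
  proof (cases "t \<ge> 0")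
    case True
    then show ?thesis
      using critical_tilt_on_line[OF \<mu> empty] by blast
  next
    case False
    \<comment> \<open>The line leaves through its other end, which is the ray spanned by \<open>- w\<close>.\<close>
    then have "\<exists>\<theta> t. chi \<mu> \<theta> = t *\<^sub>R - w \<and> critical (tilt \<mu> \<theta>)"
      using critical_tilt_on_line[OF \<mu>, of "- t" "- w"] empty by simp
    then show ?thesis
      by (metis scaleR_minus_left scaleR_minus_right)
  qed
  then obtain \<theta> t where \<theta>: "chi \<mu> \<theta> = t *\<^sub>R w" "critical (tilt \<mu> \<theta>)"
    by blast
  have "X \<bullet> w = 0" if "X \<in> ker_real \<Gamma>" for X
  proof -
    have "X \<bullet> w = (map_matrix real_of_int \<Gamma> *v X) $ r"
      by (simp add: w_def inner_vec_def matrix_vector_mult_def mult.commute)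
    with that show ?thesis
      by (simp add: ker_real_def)
  qed
  then have "tilt_equiv \<mu> \<Gamma> \<theta> 0"
    by (simp add: tilt_equiv_def chi_zero[OF assms(1)] \<theta>(1) orthogonal_comp_def orthogonal_def)
  with \<theta>(2) show ?thesis by blast
qed

end
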